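(* For every $0<\mu\leq T$ there exists a $(T,\mu)$-stabilizer for the double integrator $\dot x_1=x_2,\ \dot x_2=\alpha u$.
   Context: For positive constants $\mu\leq T$, a $(T,\mu)$-signal is a measurable function $\alpha:\mathbb{R}_{\geq 0}\to[0,1]$ such that $\int_t^{t+T}\alpha(s)\,ds\geq\mu$ for every $t\geq 0$; $\mathcal{G}(T,\mu)$ denotes the set of all $(T,\mu)$-signals. The double integrator is the system $\dot x=Ax+\alpha(t)Bu$ with $x=(x_1,x_2)^\top\in\mathbb{R}^2$, $u\in\mathbb{R}$, $A=\begin{pmatrix}0&1\\0&0\end{pmatrix}$, $B=\begin{pmatrix}0\\1\end{pmatrix}$. For a row vector $K\in\mathbb{R}^{1\times 2}$, $t_0\ge0$ and $x_0\in\mathbb{R}^2$, $x(\cdot\,;t_0,x_0,K,\alpha)$ denotes the solution of $\dot x=(A+\alpha(t)BK)x$ with $x(t_0)=x_0$. A function $\beta:\mathbb{R}_{\geq 0}\times\mathbb{R}_{\geq 0}\to\mathbb{R}_{\geq 0}$ is of class $\mathcal{KL}$ if $\beta(\cdot,t)$ is continuous, strictly increasing and vanishes at $0$ for every $t\ge0$, and $\beta(s,\cdot)$ is continuous, non-increasing and tends to zero at infinity for every $s\ge 0$. The gain $K$ is a $(T,\mu)$-stabilizer if there exists a class $\mathcal{KL}$ function $\beta$ such that, for every $\alpha\in\mathcal{G}(T,\mu)$, $x_0\in\mathbb{R}^2$ and $t_0\geq 0$, one has $|x(t;t_0,x_0,K,\alpha)|\leq\beta(|x_0|,t-t_0)$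 for all $t\geq t_0$, where $|\cdot|$ is the Euclidean norm. *)

theory Defs
  imports "HOL-Analysis.Analysis"
begin

definition signals :: "real \<Rightarrow> real \<Rightarrow> (real \<Rightarrow> real) set" where
  "signals T \<mu> = {\<alpha>. \<alpha> \<in> borel_measurable (lebesgue_on {0..}) \<and>
     (\<forall>t\<ge>0. \<alpha> t \<in> {0..1}) \<and>
     (\<forall>t\<ge>0. (LINT s:{t..t+T}|lebesgue. \<alpha> s) \<ge> \<mu>)}"

definition class_KL :: "(real \<Rightarrow> real \<Rightarrow> real) \<Rightarrow> bool" where
  "class_KL \<beta> \<longleftrightarrow>
     (\<forall>s\<ge>0. \<forall>t\<ge>0. \<beta> s t \<ge> 0) \<and>
     (\<forall>t\<ge>0. continuous_on {0..} (\<lambda>s. \<beta> s t) \<and> strict_mono_on {0..} (\<lambda>s. \<beta> s t) \<and> \<beta> 0 t = 0) \<and>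
     (\<forall>s\<ge>0. continuous_on {0..} (\<beta> s) \<and> antimono_on {0..} (\<beta> s) \<and> (\<beta> s \<longlongrightarrow> 0) at_top)"

text \<open>
  The right-hand side is only measurable in time, so solutions of
  \<open>x' = (A + \<alpha>(t) B K) x\<close>, \<open>x(t0) = x0\<close> are meant in the sense of Caratheodory: continuous
  functions satisfying the integrated equation. Only the values of \<open>x\<close> on \<open>{t0..}\<close> matter.
\<close>

definition is_solution ::
  "real^'n^'n \<Rightarrow> real^'m^'n \<Rightarrow> real^'n^'m \<Rightarrow> (real \<Rightarrow> real) \<Rightarrow> real \<Rightarrow> real^'n \<Rightarrow> (real \<Rightarrow> real^'n) \<Rightarrow> bool" where
  "is_solution A B K \<alpha> t0 x0 x \<longleftrightarrow>
     continuous_on {t0..} x \<and>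
     (\<forall>t\<ge>t0. set_integrable lebesgue {t0..t} (\<lambda>s. (A + \<alpha> s *\<^sub>R (B ** K)) *v x s) \<and>
        x t = x0 + (LINT s:{t0..t}|lebesgue. (A + \<alpha> s *\<^sub>R (B ** K)) *v x s))"

text \<open>
  For each signal the linear equation has exactly one solution on \<open>{t0..}\<close>,
  so quantifying over all solutions below is a statement about the solution.
\<close>

definition stabilizer ::
  "real^'n^'n \<Rightarrow> real^'m^'n \<Rightarrow> real \<Rightarrow> real \<Rightarrow> real^'n^'m \<Rightarrow> bool" where
  "stabilizer A B T \<mu> K \<longleftrightarrow>
     (\<exists>\<beta>. class_KL \<beta> \<and>
       (\<forall>\<alpha>\<in>signals T \<mu>. \<forall>x0. \<forall>t0\<ge>0. \<forall>x. is_solution A B K \<alpha> t0 x0 x \<longrightarrow>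
          (\<forall>t\<ge>t0. norm (x t) \<le> \<beta> (norm x0) (t - t0))))"

definition double_integrator_A :: "real^2^2" where
  "double_integrator_A = vector [vector [0, 1], vector [0, 0]]"

definition double_integrator_B :: "real^1^2" where
  "double_integrator_B = vector [vector [0], vector [1]]"

end

theory Submission
  imports Defs
begin

text \<open>
  Take the low-gain feedback \<open>u = - \<epsilon>\<^sup>2 x\<^sub>1 - \<epsilon> k x\<^sub>2\<close> with \<open>k\<^sup>2 = 2 T / \<mu>\<close>. In the coordinates
  \<open>x = \<epsilon> x\<^sub>1\<close>, \<open>y = x\<^sub>2\<close> the closed loop is \<open>x' = \<epsilon> y\<close>, \<open>y' = - \<epsilon> \<alpha> (x + k y)\<close>, which moves
  slowly over a window of length \<open>T\<close>. Up to an error of order \<open>\<epsilon>\<^sup>2\<close>, the signal may therefore be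
  replaced by its mean \<open>m\<close> over the window, and \<open>m \<ge> \<mu> / T = 2 / k\<^sup>2\<close>. Along the averaged system
  \<open>V = (4 / k) x\<^sup>2 + 2 x y + k y\<^sup>2\<close> satisfies
  \<open>V' = 2 \<epsilon> ((4 / k) x y + y\<^sup>2 - m (x + k y)\<^sup>2) \<le> - 2 \<epsilon> ((2 / k\<^sup>2) x\<^sup>2 + y\<^sup>2)\<close>
  for every such \<open>m\<close>. For small \<open>\<epsilon>\<close> this dominates the error, so \<open>V\<close> contracts by a fixed factor
  over each window.
\<close>

section \<open>The quadratic Lyapunov function: size and decrease over one increment\<close>

definition lyap :: "real \<Rightarrow> real \<Rightarrow> real \<Rightarrow> real" where
  "lyap k x y = 4 / k * x\<^sup>2 + 2 * x * y + k * y\<^sup>2"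

text \<open>AM-GM on the cross term. One common bound \<open>D\<close> lets the estimate serve both
  for the state and for its increment over a window.\<close>

lemma lyap_upper:
  assumes "k > 0" "\<bar>x\<bar> \<le> D" "\<bar>y\<bar> \<le> D"
  shows "lyap k x y \<le> (4 / k + 2 + k) * D\<^sup>2"
proof -
  have x2: "x\<^sup>2 \<le> D\<^sup>2" and y2: "y\<^sup>2 \<le> D\<^sup>2"
    using assms by (simp_all add: abs_le_square_iff[symmetric])
  have "2 * x * y \<le> x\<^sup>2 + y\<^sup>2"
    using sum_squares_bound[of x y] by simp
  then have "2 * x * y \<le> 2 * D\<^sup>2" using x2 y2 by linarith
  moreover have "4 / k * x\<^sup>2 \<le> 4 / k * D\<^sup>2" "k * y\<^sup>2 \<le> k * D\<^sup>2"
    using x2 y2 assms by (auto intro!: mult_left_mono divide_right_mono)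
  ultimately show ?thesis
    unfolding lyap_def by (simp only: distrib_right)
qed

text \<open>In the variables \<open>X = x\<close> and \<open>Y = k * y\<close>,
  \<open>k * lyap k x y\<close> becomes \<open>4 X^2 + 2 X Y + Y^2\<close>, a positive definite form
  with fixed coefficients. Replacing \<open>y\<close> by \<open>k * y\<close> only enlarges the left
  side because \<open>k \<ge> 1\<close>.\<close>

lemma lyap_lower:
  assumes "k \<ge> 1"
  shows "(\<bar>x\<bar> + \<bar>y\<bar>)\<^sup>2 \<le> 4 * k * lyap k x y"
proof -
  have "(\<bar>x\<bar> + \<bar>y\<bar>)\<^sup>2 \<le> (\<bar>x\<bar> + \<bar>k * y\<bar>)\<^sup>2"
    using mult_right_mono[OF assms, of "\<bar>y\<bar>"] assms by (intro power_mono) (auto simp: abs_mult)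
  also have "\<dots> \<le> 2 * x\<^sup>2 + 2 * (k * y)\<^sup>2"
    using sum_squares_bound[of "\<bar>x\<bar>" "\<bar>k * y\<bar>"] by (simp add: power2_sum)
  also have "\<dots> \<le> 4 * (4 * x\<^sup>2 + 2 * x * (k * y) + (k * y)\<^sup>2)"
  proof -
    have "4 * (4 * x\<^sup>2 + 2 * x * (k * y) + (k * y)\<^sup>2) - (2 * x\<^sup>2 + 2 * (k * y)\<^sup>2) =
        6 * x\<^sup>2 + 2 * (2 * x + k * y)\<^sup>2"
      by (simp add: power2_eq_square algebra_simps)
    moreover have "\<dots> \<ge> 0" by simp
    ultimately show ?thesis by linarith
  qed
  also have "\<dots> = 4 * k * lyap k x y"
    using assms by (simp add: lyap_def power2_eq_square field_simps)
  finally show ?thesis .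
qed

text \<open>The increment is an averaged Euler step \<open>(h * y, - h * m * (x + k * y))\<close>
  plus an error. Expanding the quadratic form exactly gives three contributions: the gradient along
  the Euler step yields the decrease, the gradient along the error the term with \<open>E\<close>,
  and the form at the increment itself the term with \<open>D\<close>.\<close>

lemma lyap_step:
  assumes k: "k \<ge> 1" "2 / k\<^sup>2 \<le> 1" and h: "h \<ge> 0" and m: "m \<ge> 2 / k\<^sup>2"
    and d: "\<bar>d1\<bar> \<le> D" "\<bar>d2\<bar> \<le> D"
    and e: "\<bar>d1 - h * y\<bar> \<le> E" "\<bar>d2 + h * m * (x + k * y)\<bar> \<le> E"
  shows "lyap k (x + d1) (y + d2) \<le>
    lyap k x y - h * (2 / k\<^sup>2) * (\<bar>x\<bar> + \<bar>y\<bar>)\<^sup>2 + (4 / k + 2 + k) * (2 * (\<bar>x\<bar> + \<bar>y\<bar>) * E + D\<^sup>2)"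
proof -
  define N r where "N = \<bar>x\<bar> + \<bar>y\<bar>" and "r = 2 / k\<^sup>2"
  define e1 e2 where "e1 = d1 - h * y" and "e2 = d2 + h * m * (x + k * y)"
  have k0: "k > 0" using k by simp
  have N: "\<bar>x\<bar> \<le> N" "\<bar>y\<bar> \<le> N" "N \<ge> 0" and E: "\<bar>e1\<bar> \<le> E" "\<bar>e2\<bar> \<le> E" "E \<ge> 0"
    using e by (auto simp: N_def e1_def e2_def)
  have id: "lyap k (x + d1) (y + d2) = lyap k x y
      + 2 * h * ((4 / k * x + y) * y - m * (x + k * y)\<^sup>2)
      + 2 * ((4 / k * x + y) * e1 + (x + k * y) * e2) + lyap k d1 d2"
  proof -
    \<comment> \<open>Naming the quotient makes the expansion a polynomial identity.\<close>
    define c where "c = 4 / k"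
    show ?thesis unfolding lyap_def e1_def e2_def c_def[symmetric]
      by (simp add: power2_eq_square algebra_simps)
  qed
  \<comment> \<open>The left side decreases in \<open>m\<close>, so the smallest admissible mean
    \<open>r\<close> is the worst case.\<close>
  have "(4 / k * x + y) * y - m * (x + k * y)\<^sup>2 \<le> (4 / k * x + y) * y - r * (x + k * y)\<^sup>2"
    unfolding r_def by (intro diff_left_mono mult_right_mono m) simp
  \<comment> \<open>This is why \<open>lyap\<close> has the coefficient \<open>4 / k\<close>: as
    \<open>2 * r * k = 4 / k\<close>, the cross terms cancel, and \<open>r * k^2 = 2\<close> leaves
    \<open>- y^2\<close>.\<close>
  also have "\<dots> = - (r * x\<^sup>2) - y\<^sup>2"
    using k0 by (simp add: r_def power2_eq_square field_simps)
  also have "\<dots> \<le> - (r * (x\<^sup>2 + y\<^sup>2))"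
    using mult_right_mono[OF k(2), of "y\<^sup>2"] by (simp add: r_def distrib_left)
  also have "\<dots> \<le> - (r * (N\<^sup>2 / 2))"
  proof -
    have "N\<^sup>2 / 2 \<le> x\<^sup>2 + y\<^sup>2"
      using sum_squares_bound[of "\<bar>x\<bar>" "\<bar>y\<bar>"] by (simp add: N_def power2_sum)
    then show ?thesis unfolding r_def by (intro le_imp_neg_le mult_left_mono) auto
  qed
  finally have "2 * h * ((4 / k * x + y) * y - m * (x + k * y)\<^sup>2) \<le> 2 * h * - (r * (N\<^sup>2 / 2))"
    using h by (intro mult_left_mono) auto
  then have main: "2 * h * ((4 / k * x + y) * y - m * (x + k * y)\<^sup>2) \<le> - (h * r * N\<^sup>2)"
    by simp
  have "(4 / k * x + y) * e1 \<le> (4 / k * N + N) * E"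
  proof -
    have "\<bar>4 / k * x + y\<bar> \<le> 4 / k * \<bar>x\<bar> + \<bar>y\<bar>"
      using k0 abs_triangle_ineq[of "4 / k * x" y] by (simp add: abs_mult)
    also have "\<dots> \<le> 4 / k * N + N"
      using k0 N by (intro add_mono mult_left_mono) auto
    finally have "\<bar>(4 / k * x + y) * e1\<bar> \<le> (4 / k * N + N) * E"
      unfolding abs_mult using E N k0 by (intro mult_mono) auto
    then show ?thesis by linarith
  qed
  moreover have "(x + k * y) * e2 \<le> (N + k * N) * E"
  proof -
    have "\<bar>x + k * y\<bar> \<le> \<bar>x\<bar> + k * \<bar>y\<bar>"
      using k0 abs_triangle_ineq[of x "k * y"] by (simp add: abs_mult)
    also have "\<dots> \<le> N + k * N"
      using k0 N by (intro add_mono mult_left_mono) auto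
    finally have "\<bar>(x + k * y) * e2\<bar> \<le> (N + k * N) * E"
      unfolding abs_mult using E N k0 by (intro mult_mono) auto
    then show ?thesis by linarith
  qed
  ultimately have "2 * ((4 / k * x + y) * e1 + (x + k * y) * e2)
      \<le> 2 * ((4 / k * N + N) * E + (N + k * N) * E)"
    by (intro mult_left_mono add_mono) auto
  also have "\<dots> = (4 / k + 2 + k) * (2 * N * E)"
    by (simp add: algebra_simps)
  finally have "2 * ((4 / k * x + y) * e1 + (x + k * y) * e2) \<le> (4 / k + 2 + k) * (2 * N * E)" .
  moreover have "lyap k d1 d2 \<le> (4 / k + 2 + k) * D\<^sup>2"
    using lyap_upper k0 d by blast
  ultimately show ?thesis
    using main id by (simp add: distrib_left r_def N_def)
qed

section \<open>Estimates over a single window\<close>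

text \<open>No Gronwall estimate is needed: as \<open>2 * h * (1 + k) \<le> 1\<close>, the maximum of
  \<open>\<bar>x\<bar> + \<bar>y\<bar>\<close> over the window controls its own growth.\<close>

lemma window_bounds:
  fixes x y \<alpha> :: "real \<Rightarrow> real"
  assumes ab: "a \<le> b" and k: "k \<ge> 0" and \<epsilon>: "\<epsilon> \<ge> 0"
    and small: "2 * (\<epsilon> * (b - a)) * (1 + k) \<le> 1"
    and cont: "continuous_on {a..b} x" "continuous_on {a..b} y"
    and \<alpha>: "\<And>s. s \<in> {a..b} \<Longrightarrow> 0 \<le> \<alpha> s \<and> \<alpha> s \<le> 1" "\<alpha> integrable_on {a..b}"
    and int: "(\<lambda>s. \<alpha> s * (x s + k * y s)) integrable_on {a..b}"
    and x: "\<And>s. s \<in> {a..b} \<Longrightarrow> x s = x a + \<epsilon> * integral {a..s} y"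
    and y: "\<And>s. s \<in> {a..b} \<Longrightarrow> y s = y a - \<epsilon> * integral {a..s} (\<lambda>s. \<alpha> s * (x s + k * y s))"
  defines "h \<equiv> \<epsilon> * (b - a)" and "N \<equiv> \<bar>x a\<bar> + \<bar>y a\<bar>"
  shows "\<And>s. s \<in> {a..b} \<Longrightarrow> \<bar>x s\<bar> + \<bar>y s\<bar> \<le> 2 * N"
    and "\<bar>x b - x a\<bar> \<le> 2 * h * (1 + k) * N"
    and "\<bar>y b - y a\<bar> \<le> 2 * h * (1 + k) * N"
    and "\<bar>x b - x a - h * y a\<bar> \<le> 2 * (h * (1 + k))\<^sup>2 * N"
    and "\<bar>y b - y a + \<epsilon> * integral {a..b} \<alpha> * (x a + k * y a)\<bar> \<le> 2 * (h * (1 + k))\<^sup>2 * N"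
proof -
  have h0: "h \<ge> 0" and N0: "N \<ge> 0" and hk: "h * (1 + k) \<le> 1 / 2"
    using ab \<epsilon> small by (auto simp: h_def N_def)
  have bnd: "\<bar>integral {a..s} f\<bar> \<le> B * (b - a)"
    if "s \<in> {a..b}" "f integrable_on {a..b}" "\<And>r. r \<in> {a..b} \<Longrightarrow> \<bar>f r\<bar> \<le> B" for f B s
  proof -
    have "a \<in> {a..b}" using ab by simp
    with that(3)[of a] have B: "B \<ge> 0" by linarith
    have "f integrable_on {a..s}" using that(1,2) by (auto intro: integrable_subinterval_real)
    then have "norm (integral {a..s} f) \<le> B * measure lborel {a..s}"
      using that(1,3) by (intro has_integral_bound_real[OF B, of "{}"]) auto
    also have "\<dots> \<le> B * (b - a)"
      using that(1) B by (auto intro: mult_left_mono)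
    finally show ?thesis by simp
  qed
  have yint: "y integrable_on {a..b}"
    using cont by (simp add: integrable_continuous_real)
  have comb: "\<bar>u + k * v\<bar> \<le> (1 + k) * B" if "\<bar>u\<bar> \<le> B" "\<bar>v\<bar> \<le> B" for u v B :: real
  proof -
    have "\<bar>u + k * v\<bar> \<le> \<bar>u\<bar> + k * \<bar>v\<bar>"
      using abs_triangle_ineq[of u "k * v"] k by (simp add: abs_mult)
    also have "\<dots> \<le> B + k * B" using that k by (intro add_mono mult_left_mono)
    finally show ?thesis by (simp add: algebra_simps)
  qed
  have \<alpha>_le: "\<bar>\<alpha> r * u\<bar> \<le> B" if "r \<in> {a..b}" "\<bar>u\<bar> \<le> B" for r u B
    using \<alpha>(1)[OF that(1)] that(2) mult_mono[of "\<alpha> r" 1 "\<bar>u\<bar>" B] by (simp add: abs_mult)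
  have "continuous_on {a..b} (\<lambda>s. \<bar>x s\<bar> + \<bar>y s\<bar>)"
    using cont by (intro continuous_intros)
  \<comment> \<open>Deviations are first bounded in terms of the maximum \<open>M\<close>, attained
    at \<open>c\<close>; \<open>M\<close> is compared with the initial size \<open>N\<close>
    afterwards.\<close>
  then obtain c where c: "c \<in> {a..b}" and cmax: "\<And>s. s \<in> {a..b} \<Longrightarrow> \<bar>x s\<bar> + \<bar>y s\<bar> \<le> \<bar>x c\<bar> + \<bar>y c\<bar>"
    using continuous_attains_sup[of "{a..b}" "\<lambda>s. \<bar>x s\<bar> + \<bar>y s\<bar>"] ab
    by fastforce
  define M where "M = \<bar>x c\<bar> + \<bar>y c\<bar>"
  have dev: "\<bar>x s - x a\<bar> + \<bar>y s - y a\<bar> \<le> h * (1 + k) * M" if s: "s \<in> {a..b}" for s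
  proof -
    define I J where "I = integral {a..s} y" and "J = integral {a..s} (\<lambda>s. \<alpha> s * (x s + k * y s))"
    have xs: "x s - x a = \<epsilon> * I" and ys: "y s - y a = - (\<epsilon> * J)"
      using x[OF s] y[OF s] by (simp_all add: I_def J_def)
    have "\<bar>x s - x a\<bar> + \<bar>y s - y a\<bar> = \<epsilon> * (\<bar>I\<bar> + \<bar>J\<bar>)"
      unfolding xs ys using \<epsilon> by (simp add: abs_mult distrib_left)
    moreover have "\<bar>I\<bar> + \<bar>J\<bar> \<le> (1 + k) * M * (b - a)"
    proof -
      \<comment> \<open>The sign weights turn \<open>\<bar>I\<bar> + \<bar>J\<bar>\<close> into a
        single integral, so the bound \<open>M\<close> on
        \<open>\<bar>x\<bar> + \<bar>y\<bar>\<close> is applied to both integrands at once.\<close>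
      have "integral {a..s} (\<lambda>r. sgn I * y r + sgn J * (\<alpha> r * (x r + k * y r)))
          = sgn I * I + sgn J * J"
      proof -
        have "y integrable_on {a..s}" "(\<lambda>s. \<alpha> s * (x s + k * y s)) integrable_on {a..s}"
          using s yint int by (auto intro: integrable_subinterval_real)
        then show ?thesis unfolding I_def J_def
          by (subst integral_add) (auto intro: integrable_on_mult_right)
      qed
      moreover have "\<bar>sgn I * y r + sgn J * (\<alpha> r * (x r + k * y r))\<bar> \<le> (1 + k) * M"
        if r: "r \<in> {a..b}" for r
      proof -
        have "\<bar>sgn I * y r + sgn J * (\<alpha> r * (x r + k * y r))\<bar>
          \<le> \<bar>y r\<bar> + \<bar>\<alpha> r * (x r + k * y r)\<bar>"
          by (cases I "0::real" rule: linorder_cases; cases J "0::real" rule: linorder_cases) auto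
        also have "\<bar>\<alpha> r * (x r + k * y r)\<bar> \<le> \<bar>x r\<bar> + k * \<bar>y r\<bar>"
          using abs_triangle_ineq[of "x r" "k * y r"] k by (intro \<alpha>_le[OF r]) (simp add: abs_mult)
        also have "\<bar>y r\<bar> + (\<bar>x r\<bar> + k * \<bar>y r\<bar>) \<le> (1 + k) * (\<bar>x r\<bar> + \<bar>y r\<bar>)"
          using k by (simp add: algebra_simps)
        also have "\<dots> \<le> (1 + k) * M"
          using cmax[OF r] k by (intro mult_left_mono) (auto simp: M_def)
        finally show ?thesis by simp
      qed
      moreover have "(\<lambda>r. sgn I * y r + sgn J * (\<alpha> r * (x r + k * y r))) integrable_on {a..b}"
        using yint int by (intro integrable_add integrable_on_mult_right)
      ultimately have "\<bar>sgn I * I + sgn J * J\<bar> \<le> (1 + k) * M * (b - a)"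
        using bnd[OF s, of "\<lambda>r. sgn I * y r + sgn J * (\<alpha> r * (x r + k * y r))" "(1 + k) * M"] by simp
      moreover have "sgn I * I = \<bar>I\<bar>" "sgn J * J = \<bar>J\<bar>"
        by (simp_all add: abs_sgn mult.commute)
      ultimately show ?thesis by linarith
    qed
    ultimately show ?thesis
      using mult_left_mono[OF _ \<epsilon>, of "\<bar>I\<bar> + \<bar>J\<bar>" "(1 + k) * M * (b - a)"]
      by (simp add: h_def algebra_simps)
  qed
  \<comment> \<open>Absorption: \<open>M \<le> N + M / 2\<close>.\<close>
  have M: "M \<le> 2 * N"
  proof -
    have "M \<ge> 0" by (simp add: M_def)
    then have "h * (1 + k) * M \<le> 1 / 2 * M" using hk by (intro mult_right_mono)
    moreover have "M \<le> N + (\<bar>x c - x a\<bar> + \<bar>y c - y a\<bar>)"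
      unfolding M_def N_def by linarith
    ultimately show ?thesis using dev[OF c] by linarith
  qed
  show "\<And>s. s \<in> {a..b} \<Longrightarrow> \<bar>x s\<bar> + \<bar>y s\<bar> \<le> 2 * N"
    using cmax M by (fastforce simp: M_def)
  define Q where "Q = 2 * h * (1 + k) * N"
  have dev': "\<bar>x s - x a\<bar> \<le> Q" "\<bar>y s - y a\<bar> \<le> Q" if "s \<in> {a..b}" for s
    using dev[OF that] mult_left_mono[OF M, of "h * (1 + k)"] h0 k by (auto simp: Q_def)
  have b: "b \<in> {a..b}" using ab by simp
  show "\<bar>x b - x a\<bar> \<le> 2 * h * (1 + k) * N" "\<bar>y b - y a\<bar> \<le> 2 * h * (1 + k) * N"
    using dev'[OF b] by (auto simp: Q_def)
  have Q0: "Q \<ge> 0" using h0 k N0 by (simp add: Q_def)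
  have fin: "\<epsilon> * ((1 + k) * Q * (b - a)) = 2 * (h * (1 + k))\<^sup>2 * N"
    by (simp add: Q_def h_def power2_eq_square)
  \<comment> \<open>Freezing \<open>y\<close> at its initial value leaves an integrand of size
    \<open>Q\<close>, itself of first order in \<open>h\<close>; integrating it over the window
    makes the error second order.\<close>
  have "integral {a..b} (\<lambda>s. y s - y a) = integral {a..b} y - (b - a) * y a"
    using yint ab by (subst integral_diff) auto
  then have "x b - x a - h * y a = \<epsilon> * integral {a..b} (\<lambda>s. y s - y a)"
    using x[OF b] by (simp only: h_def) (simp add: algebra_simps)
  also have "\<bar>\<dots>\<bar> \<le> \<epsilon> * ((1 + k) * Q * (b - a))"
  proof -
    have "\<bar>integral {a..b} (\<lambda>s. y s - y a)\<bar> \<le> (1 + k) * Q * (b - a)"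
    proof (rule bnd[OF b])
      show "\<bar>y r - y a\<bar> \<le> (1 + k) * Q" if "r \<in> {a..b}" for r
        using dev'(2)[OF that] mult_nonneg_nonneg[OF k Q0] by (simp add: distrib_right)
    qed (intro integrable_diff yint integrable_const_ivl)
    then show ?thesis using \<epsilon> by (simp add: abs_mult mult_left_mono)
  qed
  finally show "\<bar>x b - x a - h * y a\<bar> \<le> 2 * (h * (1 + k))\<^sup>2 * N"
    unfolding fin .
  \<comment> \<open>Only the state is frozen at \<open>a\<close>; the signal stays inside the
    integral, so that its mean appears in the leading term.\<close>
  define g where "g = (\<lambda>s. \<alpha> s * (x s + k * y s) - \<alpha> s * (x a + k * y a))"
  have g: "g integrable_on {a..b}"
    unfolding g_def using int \<alpha>(2) by (intro integrable_diff integrable_on_mult_left)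
  have "integral {a..b} g = integral {a..b} (\<lambda>s. \<alpha> s * (x s + k * y s)) - integral {a..b} \<alpha> * (x a + k * y a)"
    unfolding g_def using int \<alpha>(2) by (subst integral_diff) (auto intro: integrable_on_mult_left)
  then have "y b - y a + \<epsilon> * integral {a..b} \<alpha> * (x a + k * y a) = - (\<epsilon> * integral {a..b} g)"
    using y[OF b] by (simp only:) (simp add: algebra_simps)
  also have "\<bar>\<dots>\<bar> \<le> \<epsilon> * ((1 + k) * Q * (b - a))"
  proof -
    have "\<bar>integral {a..b} g\<bar> \<le> (1 + k) * Q * (b - a)"
    proof (rule bnd[OF b g])
      show "\<bar>g r\<bar> \<le> (1 + k) * Q" if r: "r \<in> {a..b}" for r
      proof -
        have "g r = \<alpha> r * ((x r - x a) + k * (y r - y a))"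
          by (simp add: g_def algebra_simps)
        then show ?thesis
          using \<alpha>_le[OF r comb[OF dev'[OF r]]] by simp
      qed
    qed
    then show ?thesis using \<epsilon> by (simp add: abs_mult mult_left_mono)
  qed
  finally show "\<bar>y b - y a + \<epsilon> * integral {a..b} \<alpha> * (x a + k * y a)\<bar> \<le> 2 * (h * (1 + k))\<^sup>2 * N"
    unfolding fin .
qed

text \<open>\<open>lyap_step\<close> is applied to the increment over the whole window, with
  \<open>D\<close> of first and \<open>E\<close> of second order in \<open>h\<close>. The hypothesis
  \<open>small\<close> lets the errors consume at most half of the decrease
  \<open>h * (2 / k^2) * N^2\<close>.\<close>

lemma window_contraction:
  fixes x y \<alpha> :: "real \<Rightarrow> real"
  assumes ab: "a < b" and k: "k \<ge> 1" "2 / k\<^sup>2 \<le> 1" and \<epsilon>: "\<epsilon> \<ge> 0"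
    and cont: "continuous_on {a..b} x" "continuous_on {a..b} y"
    and \<alpha>: "\<And>s. s \<in> {a..b} \<Longrightarrow> 0 \<le> \<alpha> s \<and> \<alpha> s \<le> 1" "\<alpha> integrable_on {a..b}"
      "integral {a..b} \<alpha> \<ge> 2 / k\<^sup>2 * (b - a)"
    and int: "(\<lambda>s. \<alpha> s * (x s + k * y s)) integrable_on {a..b}"
    and x: "\<And>s. s \<in> {a..b} \<Longrightarrow> x s = x a + \<epsilon> * integral {a..s} y"
    and y: "\<And>s. s \<in> {a..b} \<Longrightarrow> y s = y a - \<epsilon> * integral {a..s} (\<lambda>s. \<alpha> s * (x s + k * y s))"
  defines "G \<equiv> 4 / k + 2 + k" and "h \<equiv> \<epsilon> * (b - a)"
  assumes small: "8 * G * (1 + k)\<^sup>2 * h \<le> 1 / k\<^sup>2"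
  shows "s \<in> {a..b} \<Longrightarrow> \<bar>x s\<bar> + \<bar>y s\<bar> \<le> 2 * (\<bar>x a\<bar> + \<bar>y a\<bar>)"
    and "lyap k (x b) (y b) \<le> (1 - h / (k\<^sup>2 * G)) * lyap k (x a) (y a)"
proof -
  define N where "N = \<bar>x a\<bar> + \<bar>y a\<bar>"
  have k0: "k > 0" and h0: "h \<ge> 0" using k ab \<epsilon> by (auto simp: h_def)
  have G: "G \<ge> 2" using k0 by (simp add: G_def)
  have small2: "2 * (\<epsilon> * (b - a)) * (1 + k) \<le> 1"
  proof -
    \<comment> \<open>The smallness condition of \<open>window_bounds\<close> follows from
      \<open>small\<close>, since \<open>G * (1 + k) \<ge> 1\<close> and
      \<open>1 / k^2 \<le> 1\<close>.\<close>
    have "2 * h * (1 + k) \<le> 8 * G * (1 + k)\<^sup>2 * h"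
    proof -
      have "1 \<le> G * (1 + k)" using mult_mono[of 1 G 1 "1 + k"] G k0 by simp
      then have "(2 * h * (1 + k)) * 1 \<le> (8 * h * (1 + k)) * (G * (1 + k))"
        using h0 k0 G by (intro mult_mono) (auto intro: mult_right_mono)
      then show ?thesis by (simp add: power2_eq_square algebra_simps)
    qed
    also have "\<dots> \<le> 1" using order_trans[OF small, of 1] k(2) by simp
    finally show ?thesis by (simp add: h_def)
  qed
  note wb = window_bounds[OF less_imp_le[OF ab] less_imp_le[OF k0] \<epsilon> small2 cont \<alpha>(1,2) int x y,
      folded h_def N_def]
  show "s \<in> {a..b} \<Longrightarrow> \<bar>x s\<bar> + \<bar>y s\<bar> \<le> 2 * (\<bar>x a\<bar> + \<bar>y a\<bar>)"
    using wb(1) by (auto simp: N_def)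
  define m where "m = integral {a..b} \<alpha> / (b - a)"
  have m: "m \<ge> 2 / k\<^sup>2" unfolding m_def using \<alpha>(3) ab by (subst pos_le_divide_eq) auto
  have hm: "\<epsilon> * integral {a..b} \<alpha> = h * m" using ab by (simp add: h_def m_def)
  define C where "C = h * (1 + k)"
  have "lyap k (x a + (x b - x a)) (y a + (y b - y a)) \<le> lyap k (x a) (y a) - h * (2 / k\<^sup>2) * N\<^sup>2
      + G * (2 * N * (2 * C\<^sup>2 * N) + (2 * C * N)\<^sup>2)"
    unfolding G_def N_def
  proof (rule lyap_step[OF k h0 m])
    show "\<bar>y b - y a + h * m * (x a + k * y a)\<bar> \<le> 2 * C\<^sup>2 * (\<bar>x a\<bar> + \<bar>y a\<bar>)"
      using wb(5) by (simp add: hm N_def C_def)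
  qed (use wb in \<open>simp_all add: N_def C_def mult.assoc\<close>)
  \<comment> \<open>With \<open>D = 2 * C * N\<close> and \<open>E = 2 * C^2 * N\<close>, both error
    terms equal \<open>4 * C^2 * N^2\<close>; the first factor on the right is exactly what
    \<open>small\<close> bounds.\<close>
  also have "G * (2 * N * (2 * C\<^sup>2 * N) + (2 * C * N)\<^sup>2) = (8 * G * (1 + k)\<^sup>2 * h) * (h * N\<^sup>2)"
    by (simp add: C_def power2_eq_square algebra_simps)
  also have "\<dots> \<le> 1 / k\<^sup>2 * (h * N\<^sup>2)"
    using small h0 by (intro mult_right_mono) auto
  finally have 1: "lyap k (x b) (y b) \<le> lyap k (x a) (y a) - h / k\<^sup>2 * N\<^sup>2"
    by (simp add: field_simps)
  \<comment> \<open>Comparing \<open>N^2\<close> with the Lyapunov function turns the remaining loss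
    into a fixed fraction of its value.\<close>
  have "lyap k (x a) (y a) \<le> G * N\<^sup>2"
    unfolding G_def by (rule lyap_upper) (auto simp: k0 N_def)
  then have "h / (k\<^sup>2 * G) * lyap k (x a) (y a) \<le> h / (k\<^sup>2 * G) * (G * N\<^sup>2)"
    using h0 G by (intro mult_left_mono) auto
  also have "\<dots> = h / k\<^sup>2 * N\<^sup>2" using G by simp
  finally show "lyap k (x b) (y b) \<le> (1 - h / (k\<^sup>2 * G)) * lyap k (x a) (y a)"
    using 1 by (simp add: algebra_simps)
qed

section \<open>From contraction per window to a class KL bound\<close>

text \<open>\<open>V\<close> is iterated over the completed windows, and \<open>N\<close> at most
  doubles within the current one. The rate \<open>ln q / T\<close> of \<open>V\<close> is halved
  because \<open>V\<close> is comparable to the square of \<open>N\<close>.\<close>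

lemma geometric_decay:
  fixes N V :: "real \<Rightarrow> real"
  assumes T: "T > 0" and q: "0 < q" "q < 1" and c: "c \<ge> 0" and G: "G \<ge> 0"
    and N: "\<And>s. s \<ge> t0 \<Longrightarrow> N s \<ge> 0"
      "\<And>a s. t0 \<le> a \<Longrightarrow> s \<in> {a..a + T} \<Longrightarrow> N s \<le> 2 * N a"
    and V: "\<And>a. t0 \<le> a \<Longrightarrow> V (a + T) \<le> q * V a"
      "\<And>a. t0 \<le> a \<Longrightarrow> (N a)\<^sup>2 \<le> c * V a" "V t0 \<le> G * (N t0)\<^sup>2"
    and t: "t \<ge> t0"
  shows "N t \<le> 2 * sqrt (c * G / q) * exp (ln q / (2 * T) * (t - t0)) * N t0"
proof -
  \<comment> \<open>The number of completed windows; \<open>a\<close> is the start of the window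
    containing \<open>t\<close>.\<close>
  define n where "n = nat \<lfloor>(t - t0) / T\<rfloor>"
  define a where "a = t0 + real n * T"
  have "real n \<le> (t - t0) / T" and n: "(t - t0) / T - 1 \<le> real n"
    using t T by (auto simp: n_def)
  then have ta: "t \<in> {a..a + T}"
    using T by (auto simp: a_def field_simps)
  have a0: "a \<ge> t0" using T by (simp add: a_def)
  have "V (t0 + real m * T) \<le> q ^ m * V t0" for m
  proof (induction m)
    case (Suc m)
    have "V (t0 + real (Suc m) * T) \<le> q * V (t0 + real m * T)"
      using V(1)[of "t0 + real m * T"] T by (simp add: algebra_simps)
    also have "\<dots> \<le> q * (q ^ m * V t0)" using Suc q by simp
    finally show ?case by simp
  qed simp
  then have Va: "V a \<le> q ^ n * V t0" by (simp add: a_def)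
  have "(N t)\<^sup>2 \<le> (2 * N a)\<^sup>2"
    using N(2)[OF a0 ta] N(1)[OF t] by (rule power_mono)
  also have "\<dots> \<le> 4 * (c * (q ^ n * (G * (N t0)\<^sup>2)))"
  proof -
    have "c * V a \<le> c * (q ^ n * (G * (N t0)\<^sup>2))"
      using Va V(3) c q
      by (intro mult_left_mono order_trans[OF Va] mult_left_mono) auto
    then show ?thesis using V(2)[OF a0] by simp
  qed
  also have "q ^ n = exp (real n * ln q)" using q by (simp add: exp_of_nat_mult)
  \<comment> \<open>Here \<open>ln q < 0\<close>, so the lower bound on \<open>n\<close> bounds the
    exponential from above. The unfinished window costs the factor \<open>1 / q\<close>.\<close>
  also have "4 * (c * (exp (real n * ln q) * (G * (N t0)\<^sup>2)))
      \<le> 4 * (c * (exp (((t - t0) / T - 1) * ln q) * (G * (N t0)\<^sup>2)))"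
    using n q c G by (intro mult_left_mono mult_right_mono) (auto intro: mult_right_mono_neg)
  also have "exp (((t - t0) / T - 1) * ln q) = (exp (ln q / (2 * T) * (t - t0)))\<^sup>2 / q"
  proof -
    have "((t - t0) / T - 1) * ln q = 2 * (ln q / (2 * T) * (t - t0)) - ln q"
      using T by (simp add: field_simps)
    then show ?thesis using q by (simp only: exp_diff exp_double) simp
  qed
  also have "4 * (c * ((exp (ln q / (2 * T) * (t - t0)))\<^sup>2 / q * (G * (N t0)\<^sup>2)))
      = (2 * sqrt (c * G / q) * exp (ln q / (2 * T) * (t - t0)) * N t0)\<^sup>2"
    using c G q by (simp add: power_mult_distrib)
  finally show ?thesis
    by (rule power2_le_imp_le) (use N(1)[of t0] c G q in auto)
qed

lemma class_KL_exp:
  assumes "L > 0" "\<gamma> < 0"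
  shows "class_KL (\<lambda>s t. L * s * exp (\<gamma> * t))"
  unfolding class_KL_def
proof (intro conjI allI impI)
  fix s t :: real assume "s \<ge> 0"
  show "antimono_on {0..} (\<lambda>t. L * s * exp (\<gamma> * t))"
  proof (rule monotone_onI)
    fix t t' :: real assume "t \<le> t'"
    then have "exp (\<gamma> * t') \<le> exp (\<gamma> * t)" using assms by simp
    then show "L * s * exp (\<gamma> * t') \<le> L * s * exp (\<gamma> * t)"
      using assms \<open>s \<ge> 0\<close> by (intro mult_left_mono) auto
  qed
  have "filterlim (\<lambda>t. \<gamma> * t) at_bot at_top"
    using assms by (intro filterlim_tendsto_neg_mult_at_bot[OF tendsto_const] filterlim_ident)
  then have "((\<lambda>t. exp (\<gamma> * t)) \<longlongrightarrow> 0) at_top"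
    using exp_at_bot filterlim_compose by blast
  then show "((\<lambda>t. L * s * exp (\<gamma> * t)) \<longlongrightarrow> 0) at_top"
    by (rule tendsto_mult_right_zero)
qed (use assms in \<open>auto intro!: continuous_intros strict_mono_onI\<close>)

section \<open>Signals and solutions in terms of gauge integrals\<close>

text \<open>A bounded measurable function on a compact interval is absolutely integrable, so the
  Lebesgue integral in \<open>signals\<close> agrees with the gauge integral of the window
  estimates.\<close>

lemma signal_integral:
  assumes "\<alpha> \<in> signals T \<mu>" "a \<ge> 0"
  shows "\<alpha> integrable_on {a..a + T}" "integral {a..a + T} \<alpha> \<ge> \<mu>"
proof -
  have "\<alpha> \<in> borel_measurable (lebesgue_on {a..a + T})"
    using assms by (auto simp: signals_def intro: measurable_restrict_mono)
  moreover have "norm (\<alpha> s) \<le> 1" if "s \<in> {a..a + T}" for s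
    using assms that by (auto simp: signals_def)
  ultimately have "\<alpha> absolutely_integrable_on {a..a + T}"
    by (intro measurable_bounded_by_integrable_imp_absolutely_integrable[where g = "\<lambda>_. 1"]) auto
  then show "\<alpha> integrable_on {a..a + T}" "integral {a..a + T} \<alpha> \<ge> \<mu>"
    using assms set_lebesgue_integral_eq_integral[of "{a..a + T}" \<alpha>] by (auto simp: signals_def)
qed

text \<open>Subtracting the integrated equations at \<open>s\<close> and \<open>a\<close> eliminates
  \<open>x0\<close>, so every time from \<open>t0\<close> on can start a window.\<close>

lemma is_solution_restart:
  assumes sol: "is_solution A B K \<alpha> t0 x0 x" and a: "t0 \<le> a" "a \<le> s"
  defines "F \<equiv> \<lambda>s. (A + \<alpha> s *\<^sub>R (B ** K)) *v x s"
  shows "F integrable_on {a..s}" "x s = x a + integral {a..s} F"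
proof -
  have F: "F integrable_on {t0..t} \<and> x t = x0 + integral {t0..t} F" if "t0 \<le> t" for t
    using sol that set_lebesgue_integral_eq_integral[of "{t0..t}" F]
    by (auto simp: is_solution_def F_def)
  then have int: "F integrable_on {t0..s}" using a by simp
  then show "F integrable_on {a..s}"
    by (rule integrable_subinterval_real) (use a in auto)
  show "x s = x a + integral {a..s} F"
    using F[of s] F[of a] Henstock_Kurzweil_Integration.integral_combine[OF a int] a by simp
qed

lemma is_solution_initial: "is_solution A B K \<alpha> t0 x0 x \<Longrightarrow> x t0 = x0"
  using set_lebesgue_integral_eq_integral[of "{t0..t0}" "\<lambda>s. (A + \<alpha> s *\<^sub>R (B ** K)) *v x s"]
  by (auto simp: is_solution_def)

text \<open>The first coordinate is scaled by \<open>\<epsilon>\<close>, so that both closed-loop equations carry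
  the factor \<open>\<epsilon>\<close>.\<close>

lemma double_integrator_restart:
  fixes x :: "real \<Rightarrow> real^2" and K :: "real^2^1"
  assumes sol: "is_solution double_integrator_A double_integrator_B K \<alpha> t0 x0 x"
    and K: "K = vector [vector [- (\<epsilon>\<^sup>2), - (\<epsilon> * k)]]" and \<epsilon>: "\<epsilon> > 0" and a: "t0 \<le> a" "a \<le> s"
  defines "u \<equiv> \<lambda>s. \<epsilon> * x s $ 1" and "v \<equiv> \<lambda>s. x s $ 2"
  shows "(\<lambda>s. \<alpha> s * (u s + k * v s)) integrable_on {a..s}"
    and "u s = u a + \<epsilon> * integral {a..s} v"
    and "v s = v a - \<epsilon> * integral {a..s} (\<lambda>s. \<alpha> s * (u s + k * v s))"
proof -
  define F where "F = (\<lambda>s. (double_integrator_A + \<alpha> s *\<^sub>R (double_integrator_B ** K)) *v x s)"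
  \<comment> \<open>The gain has entries of order \<open>\<epsilon>^2\<close> and
    \<open>\<epsilon>\<close> so that one factor \<open>\<epsilon>\<close> is left after
    \<open>x s $ 1\<close> is rescaled.\<close>
  have F: "F r $ 1 = v r" "F r $ 2 = - \<epsilon> * (\<alpha> r * (u r + k * v r))" for r
    by (simp_all add: F_def K u_def v_def double_integrator_A_def double_integrator_B_def
        matrix_vector_mult_def matrix_matrix_mult_def sum_2 algebra_simps power2_eq_square)
  note F_int = is_solution_restart[OF sol a, folded F_def]
  have comp: "(\<lambda>r. F r $ i) integrable_on {a..s}"
    "integral {a..s} F $ i = integral {a..s} (\<lambda>r. F r $ i)" for i
    using F_int(1) integrable_linear[OF F_int(1) bounded_linear_vec_nth[of i]]
    by (auto simp: integral_component_eq_cart o_def)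
  \<comment> \<open>The second component is this function times the nonzero constant
    \<open>- \<epsilon>\<close>.\<close>
  show w: "(\<lambda>s. \<alpha> s * (u s + k * v s)) integrable_on {a..s}"
    using comp(1)[of 2] \<epsilon> integrable_on_cmult_iff[of "- \<epsilon>" "\<lambda>s. \<alpha> s * (u s + k * v s)"]
    by (simp only: F)
  have "x s $ i = x a $ i + integral {a..s} (\<lambda>r. F r $ i)" for i
    using arg_cong[OF F_int(2), of "\<lambda>z. z $ i"] comp(2) by simp
  from this[of 1] this[of 2]
  show "u s = u a + \<epsilon> * integral {a..s} v"
    and "v s = v a - \<epsilon> * integral {a..s} (\<lambda>s. \<alpha> s * (u s + k * v s))"
    by (simp_all only: F u_def v_def integral_mult_right) (simp_all add: distrib_left)
qed

section \<open>Choice of the gain and assembly of the bound\<close>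

theorem theorem11:
  fixes T \<mu> :: real
  assumes "0 < \<mu>" and "\<mu> \<le> T"
  shows "\<exists>K :: real^2^1. stabilizer double_integrator_A double_integrator_B T \<mu> K"
proof -
  define k where "k = sqrt (2 * T / \<mu>)"
  define G where "G = 4 / k + 2 + k"
  \<comment> \<open>The largest value allowed by the smallness condition of
    \<open>window_contraction\<close>, which then holds with equality; dividing by the window length
    \<open>T\<close> gives \<open>\<epsilon>\<close>.\<close>
  define h where "h = 1 / (8 * G * (1 + k)\<^sup>2 * k\<^sup>2)"
  define \<epsilon> where "\<epsilon> = h / T"
  define q where "q = 1 - h / (k\<^sup>2 * G)"
  define K :: "real^2^1" where "K = vector [vector [- (\<epsilon>\<^sup>2), - (\<epsilon> * k)]]"
  have T: "T > 0" using assms by simp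
  have ksq: "2 / k\<^sup>2 = \<mu> / T" using assms T by (simp add: k_def)
  have k: "k \<ge> 1" "2 / k\<^sup>2 \<le> 1"
    using assms T by (auto simp: k_def)
  have G: "G > 2" using k by (simp add: G_def add_pos_pos)
  have h: "h > 0" using G k by (simp add: h_def)
  have \<epsilon>: "\<epsilon> > 0" using h T by (simp add: \<epsilon>_def)
  have small: "8 * G * (1 + k)\<^sup>2 * h \<le> 1 / k\<^sup>2" using G k by (simp add: h_def)
  \<comment> \<open>Positivity of \<open>q\<close> amounts to \<open>h < k^2 * G\<close>, which
    follows from \<open>h \<le> 1 < k^2 * G\<close>.\<close>
  have q: "0 < q" "q < 1"
  proof -
    have "1 \<le> k\<^sup>2" using k by simp
    then have "1 * G \<le> k\<^sup>2 * G" using G by (intro mult_right_mono) auto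
    then have kG: "1 < k\<^sup>2 * G" using G by linarith
    have "1 \<le> (1 + k)\<^sup>2" using k by (intro one_le_power) simp
    then have "1 * 1 \<le> 8 * (1 + k)\<^sup>2 * (k\<^sup>2 * G)"
      using kG by (intro mult_mono) linarith+
    then have "1 \<le> 8 * G * (1 + k)\<^sup>2 * k\<^sup>2" by (simp only: ac_simps mult_1)
    then have "h \<le> 1" unfolding h_def by (subst divide_le_eq_1_pos) linarith+
    then show "0 < q" "q < 1" using kG h by (auto simp: q_def)
  qed
  define \<gamma> where "\<gamma> = ln q / (2 * T)"
  \<comment> \<open>The outer factors are the cost of passing from the scaled coordinates back to
    \<open>x\<close> and from \<open>norm x0\<close> to the scaled initial size; the middle one is
    the constant of \<open>geometric_decay\<close> with \<open>c = 4 * k\<close>.\<close>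
  define L where "L = (1 / \<epsilon> + 1) * (2 * sqrt (4 * k * G / q) * (\<epsilon> + 1))"
  have L: "L > 0" using \<epsilon> k G q by (simp add: L_def add_pos_pos)
  have "\<gamma> < 0" using q T by (simp add: \<gamma>_def divide_neg_pos)
  with L have KL: "class_KL (\<lambda>s t. L * s * exp (\<gamma> * t))" by (rule class_KL_exp)
  have "norm (x t) \<le> L * norm x0 * exp (\<gamma> * (t - t0))"
    if \<alpha>: "\<alpha> \<in> signals T \<mu>" and t0: "t0 \<ge> 0" and t: "t \<ge> t0"
      and sol: "is_solution double_integrator_A double_integrator_B K \<alpha> t0 x0 x" for \<alpha> x0 t0 x t
  proof -
    define u v where "u = (\<lambda>s. \<epsilon> * x s $ 1)" and "v = (\<lambda>s. x s $ 2)"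
    define N where "N = (\<lambda>s. \<bar>u s\<bar> + \<bar>v s\<bar>)"
    have rs: "(\<lambda>s. \<alpha> s * (u s + k * v s)) integrable_on {a..s}"
        "u s = u a + \<epsilon> * integral {a..s} v"
        "v s = v a - \<epsilon> * integral {a..s} (\<lambda>s. \<alpha> s * (u s + k * v s))"
      if "t0 \<le> a" "a \<le> s" for a s
      using double_integrator_restart[OF sol K_def \<epsilon> that] by (simp_all only: u_def v_def)
    have cont: "continuous_on {t0..} u" "continuous_on {t0..} v"
      using sol by (auto simp: is_solution_def u_def v_def intro!: continuous_intros)
    have step: "N s \<le> 2 * N a" "lyap k (u (a + T)) (v (a + T)) \<le> q * lyap k (u a) (v a)"
      if a: "t0 \<le> a" and s: "s \<in> {a..a + T}" for a s
    proof -
      have hT: "\<epsilon> * (a + T - a) = h" using T by (simp add: \<epsilon>_def)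
      have aT: "a < a + T" and a0: "a \<ge> 0" using T a t0 by auto
      have cont': "continuous_on {a..a + T} u" "continuous_on {a..a + T} v"
        using cont a by (auto elim: continuous_on_subset)
      have \<alpha>01: "0 \<le> \<alpha> r \<and> \<alpha> r \<le> 1" if "r \<in> {a..a + T}" for r
        using \<alpha> a0 that by (auto simp: signals_def)
      have mean: "integral {a..a + T} \<alpha> \<ge> 2 / k\<^sup>2 * (a + T - a)"
        using signal_integral(2)[OF \<alpha> a0] T by (simp add: ksq)
      have eqs: "u r = u a + \<epsilon> * integral {a..r} v"
        "v r = v a - \<epsilon> * integral {a..r} (\<lambda>s. \<alpha> s * (u s + k * v s))" if "r \<in> {a..a + T}" for r
        by (rule rs(2,3)[OF a]; use that in simp)+
      have small': "8 * (4 / k + 2 + k) * (1 + k)\<^sup>2 * (\<epsilon> * (a + T - a)) \<le> 1 / k\<^sup>2"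
        using small unfolding hT G_def .
      note w = window_contraction[OF aT k less_imp_le[OF \<epsilon>] cont' \<alpha>01 signal_integral(1)[OF \<alpha> a0]
          mean rs(1)[OF a less_imp_le[OF aT]] eqs small', unfolded hT, folded G_def q_def]
      show "N s \<le> 2 * N a" "lyap k (u (a + T)) (v (a + T)) \<le> q * lyap k (u a) (v a)"
        using w s by (simp_all only: N_def)
    qed
    have "N t \<le> 2 * sqrt (4 * k * G / q) * exp (ln q / (2 * T) * (t - t0)) * N t0"
    proof (rule geometric_decay[where V = "\<lambda>s. lyap k (u s) (v s)"])
      show "(N a)\<^sup>2 \<le> 4 * k * lyap k (u a) (v a)" for a
        unfolding N_def using k(1) by (rule lyap_lower)
      show "lyap k (u t0) (v t0) \<le> G * (N t0)\<^sup>2"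
        unfolding G_def using k by (intro lyap_upper) (auto simp: N_def)
      show "N s \<le> 2 * N a" if "t0 \<le> a" "s \<in> {a..a + T}" for a s
        using that by (rule step(1))
      show "lyap k (u (a + T)) (v (a + T)) \<le> q * lyap k (u a) (v a)" if "t0 \<le> a" for a
        using that T by (intro step(2)[of a a]) auto
    qed (use T q k G t in \<open>simp_all add: N_def\<close>)
    moreover have "N t0 \<le> (\<epsilon> + 1) * norm x0"
    proof -
      have "\<epsilon> * \<bar>x0 $ 1\<bar> + \<bar>x0 $ 2\<bar> \<le> \<epsilon> * norm x0 + norm x0"
        using \<epsilon> by (intro add_mono mult_left_mono component_le_norm_cart) auto
      then show ?thesis
        using \<epsilon> by (simp add: N_def u_def v_def is_solution_initial[OF sol] abs_mult distrib_right)
    qed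
    ultimately have "N t \<le> 2 * sqrt (4 * k * G / q) * exp (\<gamma> * (t - t0)) * ((\<epsilon> + 1) * norm x0)"
      using k G q unfolding \<gamma>_def[symmetric]
      by (elim order_trans) (intro mult_left_mono, auto)
    moreover have "norm (x t) \<le> (1 / \<epsilon> + 1) * N t"
    proof -
      have "norm (x t) \<le> \<bar>x t $ 1\<bar> + \<bar>x t $ 2\<bar>"
        using norm_le_l1_cart[of "x t"] by (simp add: sum_2)
      also have "\<dots> \<le> 1 / \<epsilon> * N t + N t"
        using \<epsilon> by (intro add_mono) (auto simp: N_def u_def v_def abs_mult field_simps)
      finally show ?thesis by (simp add: distrib_right)
    qed
    moreover have "1 / \<epsilon> + 1 \<ge> 0" using \<epsilon> by simp
    ultimately have "norm (x t) \<le> (1 / \<epsilon> + 1) *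
        (2 * sqrt (4 * k * G / q) * exp (\<gamma> * (t - t0)) * ((\<epsilon> + 1) * norm x0))"
      by (meson mult_left_mono order_trans)
    then show ?thesis by (simp add: L_def ac_simps)
  qed
  with KL have "stabilizer double_integrator_A double_integrator_B T \<mu> K"
    unfolding stabilizer_def by blast
  then show ?thesis ..
qed

end
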